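(* Let $R$ be a commutative unitary ring in which $2$ is invertible, let $\mathcal{A}$ be a commutative unitary $R$-algebra, and let $\mathcal{L}$ be a strongly non-singular Lie pseudoalgebra over $R$ and $\mathcal{A}$. Then: (a) for every Lie ideal $\mathcal{K}$ of $\mathcal{L}$ there is an $\mathcal{L}$-invariant (associative) ideal $I$ of $\mathcal{A}$ such that $\hat{\mathcal{K}}(\mathcal{A})\subset I$ and $I\mathcal{L}\subset\mathcal{K}\subset\mathcal{L}_I$; (b) for every Lie ideal $\mathcal{K}$ of $\mathcal{L}$, the ideal $[\mathcal{L},\mathcal{K}]$ is modular. Moreover, $\mathcal{K}$ is modular if and only if $[\mathcal{L},\mathcal{K}]=\mathcal{K}$.
   Context: A Lie pseudoalgebra over $R$ and $\mathcal{A}$ is an $\mathcal{A}$-module $\mathcal{L}$ together with a bracket $[\cdot,\cdot]:\mathcal{L}\times\mathcal{L}\to\mathcal{L}$ and an $\mathcal{A}$-module morphism $a:\mathcal{L}\to\mathrm{Der}(\mathcal{A})$ (the anchor) into the $\mathcal{A}$-module of ($R$-linear) derivations of $\mathcal{A}$, such that: (i) the bracket is $R$-bilinear, alternating and satisfies the Jacobi identity; (ii) $[X,fY]=f[X,Y]+a(X)(f)Y$ for all $X,Y\in\mathcal{L}$, $f\in\mathcal{A}$; (iii) $a([X,Y])=[a(X),a(Y)]$ for all $X,Y\in\mathcal{L}$. The Lie algebra structure of $\mathcal{L}$ is considered over $R$; Lie ideals are ideals of this $R$-Lie algebra. Notation: $\hat X=a(X)$. For $\mathcal{K}\subset\mathcal{L}$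 put $\hat{\mathcal{K}}=\{\hat X:X\in\mathcal{K}\}$ and $\hat{\mathcal{K}}(\mathcal{A})=\mathrm{span}\{\hat X(f):X\in\mathcal{K},\ f\in\mathcal{A}\}$. $\mathcal{L}$ is strongly non-singular if $\hat{\mathcal{L}}(\mathcal{A})=\mathcal{A}$. For an ideal $I\subset\mathcal{A}$: $I\mathcal{L}$ is the $\mathcal{A}$-submodule of $\mathcal{L}$ spanned by the products $fX$ ($f\in I$, $X\in\mathcal{L}$); $\mathcal{L}_I=\{X\in\mathcal{L}:\hat X(\mathcal{A})\subset I\}$; $I$ is $\mathcal{L}$-invariant if $\hat X(f)\in I$ for all $X\in\mathcal{L}$, $f\in I$. A subset of $\mathcal{L}$ is modular if it is an $\mathcal{A}$-submodule. Brackets of subsets denote the $R$-linear span of the brackets of elements. *)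

theory Defs
  imports "HOL-Algebra.Module" "HOL-Algebra.Ideal" "HOL.Hull"
begin

definition module_span ::
    "('a, 'k) ring_scheme \<Rightarrow> ('a, 'm, 'n) module_scheme \<Rightarrow> 'm set \<Rightarrow> 'm set" where
  "module_span R M S = (\<lambda>N. submodule N R M) hull S"

text \<open>
  An \<open>A\<close>-module \<open>M\<close>, for an \<open>R\<close>-algebra \<open>A\<close>, is an \<open>R\<close>-module through the structure map
  \<open>r \<mapsto> r \<odot> 1\<close> of \<open>A\<close>. The ring fields \<open>mult\<close> and \<open>one\<close> of a \<open>module\<close> record carry no
  information and are passed on unchanged.
\<close>

definition restrict_scalars ::
    "('r, 'a, 'n) module_scheme \<Rightarrow> ('a, 'm, 'p) module_scheme \<Rightarrow> ('r, 'm) module" where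
  "restrict_scalars A M =
     \<lparr>carrier = carrier M, monoid.mult = monoid.mult M, one = one M,
      ring.zero = ring.zero M, add = add M,
      smult = (\<lambda>r x. (r \<odot>\<^bsub>A\<^esub> \<one>\<^bsub>A\<^esub>) \<odot>\<^bsub>M\<^esub> x)\<rparr>"

locale lie_algebra = module R M
  for R (structure) and M (structure) and br :: "'m \<Rightarrow> 'm \<Rightarrow> 'm" +
  assumes br_closed: "\<lbrakk>x \<in> carrier M; y \<in> carrier M\<rbrakk> \<Longrightarrow> br x y \<in> carrier M"
    and br_add_left:
      "\<lbrakk>x \<in> carrier M; y \<in> carrier M; z \<in> carrier M\<rbrakk>
        \<Longrightarrow> br (x \<oplus>\<^bsub>M\<^esub> y) z = br x z \<oplus>\<^bsub>M\<^esub> br y z"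
    and br_add_right:
      "\<lbrakk>x \<in> carrier M; y \<in> carrier M; z \<in> carrier M\<rbrakk>
        \<Longrightarrow> br x (y \<oplus>\<^bsub>M\<^esub> z) = br x y \<oplus>\<^bsub>M\<^esub> br x z"
    and br_smult_left:
      "\<lbrakk>r \<in> carrier R; x \<in> carrier M; y \<in> carrier M\<rbrakk>
        \<Longrightarrow> br (r \<odot>\<^bsub>M\<^esub> x) y = r \<odot>\<^bsub>M\<^esub> br x y"
    and br_smult_right:
      "\<lbrakk>r \<in> carrier R; x \<in> carrier M; y \<in> carrier M\<rbrakk>
        \<Longrightarrow> br x (r \<odot>\<^bsub>M\<^esub> y) = r \<odot>\<^bsub>M\<^esub> br x y"
    and br_alternating: "x \<in> carrier M \<Longrightarrow> br x x = \<zero>\<^bsub>M\<^esub>"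
    and br_jacobi:
      "\<lbrakk>x \<in> carrier M; y \<in> carrier M; z \<in> carrier M\<rbrakk>
        \<Longrightarrow> br x (br y z) \<oplus>\<^bsub>M\<^esub> br y (br z x) \<oplus>\<^bsub>M\<^esub> br z (br x y) = \<zero>\<^bsub>M\<^esub>"

definition derivations :: "('r, 'k) ring_scheme \<Rightarrow> ('r, 'a, 'n) module_scheme \<Rightarrow> ('a \<Rightarrow> 'a) set" where
  "derivations R A =
     {D. D \<in> carrier A \<rightarrow> carrier A
       \<and> (\<forall>f\<in>carrier A. \<forall>g\<in>carrier A. D (f \<oplus>\<^bsub>A\<^esub> g) = D f \<oplus>\<^bsub>A\<^esub> D g)
       \<and> (\<forall>r\<in>carrier R. \<forall>f\<in>carrier A. D (r \<odot>\<^bsub>A\<^esub> f) = r \<odot>\<^bsub>A\<^esub> D f)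
       \<and> (\<forall>f\<in>carrier A. \<forall>g\<in>carrier A.
            D (f \<otimes>\<^bsub>A\<^esub> g) = (D f \<otimes>\<^bsub>A\<^esub> g) \<oplus>\<^bsub>A\<^esub> (f \<otimes>\<^bsub>A\<^esub> D g))}"

record ('a, 'l) lie_pseudoalgebra = "('a, 'l) module" +
  lie_br :: "'l \<Rightarrow> 'l \<Rightarrow> 'l"
  anchor :: "'l \<Rightarrow> 'a \<Rightarrow> 'a"

text \<open>
  The module operations and the commutator of \<open>Der(A)\<close> are written out pointwise on the carrier,
  so that derivations agreeing on \<open>carrier A\<close> are not distinguished.
\<close>

locale lie_pseudoalgebra =
  algebra R A + L?: module A L + lie_algebra R "restrict_scalars A L" "lie_br L"
  for R (structure) and A (structure) and L (structure) +
  assumes anchor_derivation: "X \<in> carrier L \<Longrightarrow> anchor L X \<in> derivations R A"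
    and anchor_add:
      "\<lbrakk>X \<in> carrier L; Y \<in> carrier L; f \<in> carrier A\<rbrakk>
        \<Longrightarrow> anchor L (X \<oplus>\<^bsub>L\<^esub> Y) f = anchor L X f \<oplus>\<^bsub>A\<^esub> anchor L Y f"
    and anchor_smult:
      "\<lbrakk>g \<in> carrier A; X \<in> carrier L; f \<in> carrier A\<rbrakk>
        \<Longrightarrow> anchor L (g \<odot>\<^bsub>L\<^esub> X) f = g \<otimes>\<^bsub>A\<^esub> anchor L X f"
    and lie_br_leibniz:
      "\<lbrakk>X \<in> carrier L; Y \<in> carrier L; f \<in> carrier A\<rbrakk>
        \<Longrightarrow> lie_br L X (f \<odot>\<^bsub>L\<^esub> Y) = f \<odot>\<^bsub>L\<^esub> lie_br L X Y \<oplus>\<^bsub>L\<^esub> anchor L X f \<odot>\<^bsub>L\<^esub> Y"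
    and anchor_lie_br:
      "\<lbrakk>X \<in> carrier L; Y \<in> carrier L; f \<in> carrier A\<rbrakk>
        \<Longrightarrow> anchor L (lie_br L X Y) f
          = anchor L X (anchor L Y f) \<ominus>\<^bsub>A\<^esub> anchor L Y (anchor L X f)"

text \<open>The following notions presuppose a Lie pseudoalgebra \<open>L\<close> over \<open>R\<close> and \<open>A\<close>.\<close>

definition lie_ideal ::
    "('r, 'k) ring_scheme \<Rightarrow> ('r, 'a, 'n) module_scheme \<Rightarrow> ('a, 'l, 'p) lie_pseudoalgebra_scheme
      \<Rightarrow> 'l set \<Rightarrow> bool" where
  "lie_ideal R A L K \<longleftrightarrow>
     submodule K R (restrict_scalars A L) \<and> (\<forall>X\<in>carrier L. \<forall>Y\<in>K. lie_br L X Y \<in> K)"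

definition lie_br_span ::
    "('r, 'k) ring_scheme \<Rightarrow> ('r, 'a, 'n) module_scheme \<Rightarrow> ('a, 'l, 'p) lie_pseudoalgebra_scheme
      \<Rightarrow> 'l set \<Rightarrow> 'l set \<Rightarrow> 'l set" where
  "lie_br_span R A L S T =
     module_span R (restrict_scalars A L) {lie_br L X Y |X Y. X \<in> S \<and> Y \<in> T}"

definition anchor_image_span ::
    "('r, 'k) ring_scheme \<Rightarrow> ('r, 'a, 'n) module_scheme \<Rightarrow> ('a, 'l, 'p) lie_pseudoalgebra_scheme
      \<Rightarrow> 'l set \<Rightarrow> 'a set" where
  "anchor_image_span R A L K = module_span R A {anchor L X f |X f. X \<in> K \<and> f \<in> carrier A}"

definition strongly_nonsingular ::
    "('r, 'k) ring_scheme \<Rightarrow> ('r, 'a, 'n) module_scheme \<Rightarrow> ('a, 'l, 'p) lie_pseudoalgebra_scheme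
      \<Rightarrow> bool" where
  "strongly_nonsingular R A L \<longleftrightarrow> anchor_image_span R A L (carrier L) = carrier A"

definition ideal_smult ::
    "('r, 'a, 'n) module_scheme \<Rightarrow> ('a, 'l, 'p) lie_pseudoalgebra_scheme \<Rightarrow> 'a set \<Rightarrow> 'l set" where
  "ideal_smult A L I = module_span A L {f \<odot>\<^bsub>L\<^esub> X |f X. f \<in> I \<and> X \<in> carrier L}"

definition anchor_into ::
    "('r, 'a, 'n) module_scheme \<Rightarrow> ('a, 'l, 'p) lie_pseudoalgebra_scheme \<Rightarrow> 'a set \<Rightarrow> 'l set" where
  "anchor_into A L I = {X \<in> carrier L. anchor L X ` carrier A \<subseteq> I}"

definition anchor_invariant ::
    "('a, 'l, 'p) lie_pseudoalgebra_scheme \<Rightarrow> 'a set \<Rightarrow> bool" where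
  "anchor_invariant L I \<longleftrightarrow> (\<forall>X\<in>carrier L. \<forall>f\<in>I. anchor L X f \<in> I)"

definition modular ::
    "('r, 'a, 'n) module_scheme \<Rightarrow> ('a, 'l, 'p) lie_pseudoalgebra_scheme \<Rightarrow> 'l set \<Rightarrow> bool" where
  "modular A L K \<longleftrightarrow> submodule K A L"

end

theory Submission
  imports Defs
begin

text \<open>
  Write \<open>X(f)\<close> for \<open>anchor L X f\<close> and let \<open>K\<close> be a Lie ideal. The ideal of part (a) is the largest
  candidate, the multiplier ideal \<open>I = {h. h L \<subseteq> K}\<close>. It is invariant because
  \<open>X(h) Z = [X, h Z] - h [X, Z]\<close>, so all of (a) comes down to \<open>Y(f) \<in> I\<close> for \<open>Y \<in> K\<close>.

  Three observations give this. First, in the combination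
  \<open>[g X, [f X, Y]] - [f g X, [X, Y]] - [g X(f) X, Y]\<close> of elements of \<open>K\<close> everything cancels except
  \<open>p X\<close> with \<open>p = Y(f) X(g) + Y(g) X(f)\<close>. Scaling \<open>X\<close> by \<open>t \<in> A\<close> multiplies \<open>p X\<close> by \<open>t\<^sup>2\<close>, and since
  \<open>2\<close> is invertible, polarization puts all \<open>A\<close>-multiples of \<open>p X\<close> into \<open>K\<close>
  (\<open>symmetric_product_smult_mem_modular_core\<close>). Secondly, if all \<open>A\<close>-multiples of \<open>Z\<close> lie in \<open>K\<close>, then
  \<open>Z(A) \<subseteq> I\<close> (\<open>anchor_modular_core_mem\<close>). Hence \<open>p X(l) \<in> I\<close>: modulo \<open>I\<close>, the product
  \<open>Y(f) X(g) X(l)\<close> is antisymmetric in \<open>f, g\<close> and symmetric in \<open>g, l\<close>, so it vanishes, and in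
  particular \<open>Y(f) X(k)\<^sup>2 \<in> I\<close> (\<open>anchor_times_square_mem\<close>). Thirdly, the colon ideal of \<open>Y(f)\<close> in \<open>I\<close>
  thus contains the squares of all \<open>X(k)\<close>. By strong non-singularity the \<open>X(k)\<close> span \<open>A\<close>, so \<open>1\<close> is nilpotent modulo the colon ideal (\<open>one_mem_ideal_if_anchor_squares\<close>), that is, \<open>Y(f) \<in> I\<close>.

  For part (b) let \<open>N = [L, K]\<close>. As \<open>f [X, Y] = [f X, Y] + Y(f) X\<close>, modularity of \<open>N\<close> follows from
  \<open>I L \<subseteq> N\<close>, a strengthening of \<open>I L \<subseteq> K\<close>. For \<open>h \<in> I\<close> the difference \<open>[Y, k h X] - [k Y, h X]\<close>
  shows that \<open>Y(k) h X + X(k) h Y \<in> N\<close>; the same play of symmetry and squares of anchors then gives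
  \<open>h Z \<in> N\<close> (\<open>multiplier_ideal_smult_mem_lie_br_span\<close>). Finally, if \<open>K\<close> is modular, then
  \<open>X(k) Y = [X, k Y] - k [X, Y] \<in> N\<close> for \<open>Y \<in> K\<close>, and the \<open>X(k)\<close> generate the unit ideal.
\<close>

section \<open>Spans and radicals\<close>

lemma (in module) module_span_least:
  "\<lbrakk>submodule N R M; S \<subseteq> N\<rbrakk> \<Longrightarrow> module_span R M S \<subseteq> N"
  unfolding module_span_def by (rule hull_minimal)

lemma (in module) module_span_superset: "S \<subseteq> module_span R M S"
  unfolding module_span_def by (rule hull_subset)

lemma (in module) submodule_module_span:
  assumes "S \<subseteq> carrier M"
  shows "submodule (module_span R M S) R M"
proof -
  have in_span: "x \<in> module_span R M S \<longleftrightarrow> (\<forall>N. submodule N R M \<and> S \<subseteq> N \<longrightarrow> x \<in> N)" for x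
    by (auto simp: module_span_def hull_def)
  have zero: "\<zero>\<^bsub>M\<^esub> \<in> N" if "submodule N R M" for N
    using subgroup.one_closed[OF submodule.axioms(1)[OF that]] by simp
  show ?thesis
  proof (rule submoduleI)
    show "module_span R M S \<subseteq> carrier M"
      using assms by (intro module_span_least carrier_is_submodule)
  qed (unfold in_span, auto intro: zero submoduleE(3-5))
qed

lemma (in abelian_group) add_diff_cancel_left:
  "\<lbrakk>x \<in> carrier G; y \<in> carrier G\<rbrakk> \<Longrightarrow> (x \<oplus> y) \<ominus> x = y"
  by (simp add: a_minus_def a_comm[of x y] a_assoc r_neg)

lemma (in abelian_group) add_diff_diff_cancel_left:
  "\<lbrakk>x \<in> carrier G; y \<in> carrier G; z \<in> carrier G\<rbrakk> \<Longrightarrow> (x \<oplus> y) \<ominus> (x \<ominus> z) = y \<oplus> z"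
  by (simp add: a_minus_def minus_add a_assoc a_lcomm[of x y] r_neg2)

lemma (in cring) square_polarization:
  "\<lbrakk>k \<in> carrier R; p \<in> carrier R\<rbrakk>
    \<Longrightarrow> ((\<one> \<oplus> k) \<otimes> (\<one> \<oplus> k)) \<otimes> p \<ominus> (k \<otimes> k) \<otimes> p \<ominus> p = k \<otimes> p \<oplus> k \<otimes> p"
  by algebra

text \<open>
  The coefficients of \<open>X\<close> on the two sides of the identity for the iterated bracket
  \<open>[g X, [f X, Y]]\<close> below, as an identity of polynomials.
\<close>

lemma (in cring) iterated_bracket_coefficient:
  "\<lbrakk>f \<in> carrier R; g \<in> carrier R; p \<in> carrier R; q \<in> carrier R; u \<in> carrier R; v \<in> carrier R; w \<in> carrier R\<rbrakk>
    \<Longrightarrow> p \<ominus> f \<otimes> u \<ominus> g \<otimes> v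
      = \<ominus> ((v \<ominus> w) \<otimes> g \<oplus> f \<otimes> u) \<oplus> \<ominus> (q \<oplus> g \<otimes> w) \<oplus> (p \<oplus> q)"
  by algebra

lemma (in cring) idealI_commutative:
  assumes I: "I \<subseteq> carrier R" "\<zero> \<in> I" "\<And>a b. \<lbrakk>a \<in> I; b \<in> I\<rbrakk> \<Longrightarrow> a \<oplus> b \<in> I"
    "\<And>a b. \<lbrakk>a \<in> I; b \<in> carrier R\<rbrakk> \<Longrightarrow> b \<otimes> a \<in> I"
  shows "ideal I R"
proof (rule idealI)
  have "\<ominus> a \<in> I" if "a \<in> I" for a
    using I(4)[OF that, of "\<ominus> \<one>"] that I(1) by (auto simp: l_minus)
  then show "subgroup I (add_monoid R)"
    using I by (intro add.subgroupI) (auto simp: a_inv_def)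
  show "ring R" by (rule ring_axioms)
  show "x \<otimes> a \<in> I" "a \<otimes> x \<in> I" if "a \<in> I" "x \<in> carrier R" for a x
    using I(4)[OF that] that I(1) m_comm by auto
qed

definition ideal_radical :: "('a, 'k) ring_scheme \<Rightarrow> 'a set \<Rightarrow> 'a set" where
  "ideal_radical A J = {a \<in> carrier A. \<exists>n::nat. a [^]\<^bsub>A\<^esub> n \<in> J}"

text \<open>
  The factor \<open>c\<close> replaces the binomial theorem: splitting one factor \<open>a \<oplus> b\<close> off the power moves an
  \<open>a\<close> or a \<open>b\<close> into \<open>c\<close> and lowers \<open>m\<close> or \<open>n\<close> by one.
\<close>

lemma (in cring) power_add_mem_ideal:
  fixes m n :: nat
  assumes J: "ideal J R" and a: "a \<in> carrier R" and b: "b \<in> carrier R"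
    and c: "c \<in> carrier R" "c \<otimes> a [^] m \<in> J" "c \<otimes> b [^] n \<in> J"
  shows "c \<otimes> (a \<oplus> b) [^] (m + n) \<in> J"
  using c
proof (induction "m + n" arbitrary: m n c)
  case 0
  then show ?case by simp
next
  case (Suc p)
  interpret J: ideal J R by fact
  show ?case
  proof (cases "m = 0 \<or> n = 0")
    case True
    then have "c \<in> J" using Suc.prems by auto
    then show ?thesis using a b by (auto intro: J.I_r_closed)
  next
    case False
    then obtain m' n' where mn: "m = Suc m'" "n = Suc n'"
      by (meson not0_implies_Suc)
    have p: "p = m' + n" "p = m + n'" using Suc.hyps(2) mn by auto
    have "(c \<otimes> a) \<otimes> (a \<oplus> b) [^] (m' + n) \<in> J"
    proof (rule Suc.hyps(1)[OF p(1)])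
      have "(c \<otimes> b [^] n) \<otimes> a \<in> J" using Suc.prems a by (rule_tac J.I_r_closed)
      then show "(c \<otimes> a) \<otimes> b [^] n \<in> J" using Suc.prems(1) a b by (simp add: m_ac)
    qed (use Suc.prems a mn in \<open>auto simp: m_ac\<close>)
    moreover have "(c \<otimes> b) \<otimes> (a \<oplus> b) [^] (m + n') \<in> J"
    proof (rule Suc.hyps(1)[OF p(2)])
      have "(c \<otimes> a [^] m) \<otimes> b \<in> J" using Suc.prems b by (rule_tac J.I_r_closed)
      then show "(c \<otimes> b) \<otimes> a [^] m \<in> J" using Suc.prems(1) a b by (simp add: m_ac)
    qed (use Suc.prems b mn in \<open>auto simp: m_ac\<close>)
    ultimately have "(c \<otimes> a) \<otimes> (a \<oplus> b) [^] p \<oplus> (c \<otimes> b) \<otimes> (a \<oplus> b) [^] p \<in> J"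
      using p by (simp add: J.a_closed)
    moreover have "(c \<otimes> a) \<otimes> (a \<oplus> b) [^] p \<oplus> (c \<otimes> b) \<otimes> (a \<oplus> b) [^] p
        = c \<otimes> (a \<oplus> b) [^] Suc p"
      using Suc.prems(1) a b by (simp add: r_distr l_distr m_ac)
    ultimately show ?thesis using Suc.hyps(2) by simp
  qed
qed

context algebra
begin

text \<open>
  The radical is even an ideal. Closure under the scalars of \<open>R\<close> is recorded because strong
  non-singularity speaks of \<open>R\<close>-linear spans.
\<close>

lemma submodule_ideal_radical:
  assumes J: "ideal J M"
  shows "submodule (ideal_radical M J) R M"
proof (rule submoduleI)
  interpret J: ideal J M by fact
  have I: "a \<in> ideal_radical M J" if "a \<in> carrier M" "a [^]\<^bsub>M\<^esub> (n::nat) \<in> J" for a n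
    using that by (auto simp: ideal_radical_def)
  have scale: "b \<otimes>\<^bsub>M\<^esub> a \<in> ideal_radical M J"
    if b: "b \<in> carrier M" and a: "a \<in> ideal_radical M J" for a b
  proof -
    obtain n :: nat where n: "a \<in> carrier M" "a [^]\<^bsub>M\<^esub> n \<in> J"
      using a by (auto simp: ideal_radical_def)
    then have "(b \<otimes>\<^bsub>M\<^esub> a) [^]\<^bsub>M\<^esub> n \<in> J"
      using b by (simp add: nat_pow_distrib J.I_l_closed)
    then show ?thesis using n b by (intro I) auto
  qed
  show "ideal_radical M J \<subseteq> carrier M"
    by (auto simp: ideal_radical_def)
  show "\<zero>\<^bsub>M\<^esub> \<in> ideal_radical M J"
    using I[of "\<zero>\<^bsub>M\<^esub>" 1] J.zero_closed by simp
  fix a b r assume a: "a \<in> ideal_radical M J"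
  then have aM: "a \<in> carrier M" by (simp add: ideal_radical_def)
  show "\<ominus>\<^bsub>M\<^esub> a \<in> ideal_radical M J"
    using scale[of "\<ominus>\<^bsub>M\<^esub> \<one>\<^bsub>M\<^esub>" a] a aM by (simp add: l_minus)
  show "r \<odot>\<^bsub>M\<^esub> a \<in> ideal_radical M J" if "r \<in> carrier R"
    using scale[of "r \<odot>\<^bsub>M\<^esub> \<one>\<^bsub>M\<^esub>" a] a aM that by (simp add: smult_assoc2)
  show "a \<oplus>\<^bsub>M\<^esub> b \<in> ideal_radical M J" if b: "b \<in> ideal_radical M J"
  proof -
    have bM: "b \<in> carrier M" using b by (simp add: ideal_radical_def)
    obtain m n :: nat where mn: "a [^]\<^bsub>M\<^esub> m \<in> J" "b [^]\<^bsub>M\<^esub> n \<in> J"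
      using a b by (auto simp: ideal_radical_def)
    have "(a \<oplus>\<^bsub>M\<^esub> b) [^]\<^bsub>M\<^esub> (m + n) \<in> J"
      using power_add_mem_ideal[OF J aM bM, of "\<one>\<^bsub>M\<^esub>" m n] mn aM bM by simp
    then show ?thesis using aM bM by (intro I) auto
  qed
qed

lemma obtain_half:
  assumes "\<one>\<^bsub>R\<^esub> \<oplus>\<^bsub>R\<^esub> \<one>\<^bsub>R\<^esub> \<in> Units R"
  obtains r where "r \<in> carrier R" "r \<odot>\<^bsub>M\<^esub> \<one>\<^bsub>M\<^esub> \<oplus>\<^bsub>M\<^esub> r \<odot>\<^bsub>M\<^esub> \<one>\<^bsub>M\<^esub> = \<one>\<^bsub>M\<^esub>"
proof
  let ?r = "inv\<^bsub>R\<^esub> (\<one>\<^bsub>R\<^esub> \<oplus>\<^bsub>R\<^esub> \<one>\<^bsub>R\<^esub>)"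
  show r: "?r \<in> carrier R" using assms by (rule R.Units_inv_closed)
  have "?r \<odot>\<^bsub>M\<^esub> \<one>\<^bsub>M\<^esub> \<oplus>\<^bsub>M\<^esub> ?r \<odot>\<^bsub>M\<^esub> \<one>\<^bsub>M\<^esub> = (?r \<oplus>\<^bsub>R\<^esub> ?r) \<odot>\<^bsub>M\<^esub> \<one>\<^bsub>M\<^esub>"
    using r by (simp add: smult_l_distr)
  also have "?r \<oplus>\<^bsub>R\<^esub> ?r = ?r \<otimes>\<^bsub>R\<^esub> (\<one>\<^bsub>R\<^esub> \<oplus>\<^bsub>R\<^esub> \<one>\<^bsub>R\<^esub>)"
    using r by (simp add: R.r_distr)
  also have "\<dots> = \<one>\<^bsub>R\<^esub>" using assms by (rule R.Units_l_inv)
  finally show "?r \<odot>\<^bsub>M\<^esub> \<one>\<^bsub>M\<^esub> \<oplus>\<^bsub>M\<^esub> ?r \<odot>\<^bsub>M\<^esub> \<one>\<^bsub>M\<^esub> = \<one>\<^bsub>M\<^esub>" by (simp add: smult_one)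
qed

lemma halve_mem_ideal:
  assumes two: "\<one>\<^bsub>R\<^esub> \<oplus>\<^bsub>R\<^esub> \<one>\<^bsub>R\<^esub> \<in> Units R" and J: "ideal J M"
    and a: "a \<in> carrier M" "a \<oplus>\<^bsub>M\<^esub> a \<in> J"
  shows "a \<in> J"
proof -
  obtain r where r: "r \<in> carrier R" "r \<odot>\<^bsub>M\<^esub> \<one>\<^bsub>M\<^esub> \<oplus>\<^bsub>M\<^esub> r \<odot>\<^bsub>M\<^esub> \<one>\<^bsub>M\<^esub> = \<one>\<^bsub>M\<^esub>"
    using obtain_half[OF two] .
  have h: "r \<odot>\<^bsub>M\<^esub> \<one>\<^bsub>M\<^esub> \<in> carrier M"
    using r(1) by simp
  have "(r \<odot>\<^bsub>M\<^esub> \<one>\<^bsub>M\<^esub>) \<otimes>\<^bsub>M\<^esub> (a \<oplus>\<^bsub>M\<^esub> a) = a"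
    using l_distr[OF h h a(1)] r_distr[OF a(1) a(1) h] r(2) a(1) by simp
  then show ?thesis using ideal.I_l_closed[OF J a(2) h] by simp
qed

lemma submodule_ideal:
  assumes "ideal J M"
  shows "submodule J R M"
proof (rule submoduleI)
  interpret J: ideal J M by fact
  show "J \<subseteq> carrier M" by (rule J.a_subset)
  fix a assume a: "a \<in> J"
  show "r \<odot>\<^bsub>M\<^esub> a \<in> J" if "r \<in> carrier R" for r
    using J.I_l_closed[OF a, of "r \<odot>\<^bsub>M\<^esub> \<one>\<^bsub>M\<^esub>"] J.Icarr[OF a] that by (simp add: smult_assoc2)
  show "\<ominus>\<^bsub>M\<^esub> a \<in> J" using a by (rule J.a_inv_closed)
  show "a \<oplus>\<^bsub>M\<^esub> b \<in> J" if "b \<in> J" for b using a that by (rule J.a_closed)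
qed (rule additive_subgroup.zero_closed[OF ideal.axioms(1)[OF assms]])

text \<open>
  The radical of \<open>J\<close> is a submodule that contains the generators \<open>S\<close>, hence also \<open>\<one>\<close>; but the powers
  of \<open>\<one>\<close> are \<open>\<one>\<close>.
\<close>

lemma one_mem_ideal_if_squares_of_generators:
  assumes J: "ideal J M" and span: "\<one>\<^bsub>M\<^esub> \<in> module_span R M S" and S: "S \<subseteq> carrier M"
    and sq: "\<And>s. s \<in> S \<Longrightarrow> s \<otimes>\<^bsub>M\<^esub> s \<in> J"
  shows "\<one>\<^bsub>M\<^esub> \<in> J"
proof -
  have "S \<subseteq> ideal_radical M J"
  proof
    fix s assume s: "s \<in> S"
    then have "s [^]\<^bsub>M\<^esub> (2::nat) \<in> J" using sq[OF s] S by (auto simp: numeral_2_eq_2)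
    then show "s \<in> ideal_radical M J" using s S by (auto simp: ideal_radical_def)
  qed
  then have "\<one>\<^bsub>M\<^esub> \<in> ideal_radical M J"
    using module_span_least[OF submodule_ideal_radical[OF J]] span by blast
  then show ?thesis by (auto simp: ideal_radical_def)
qed

end

section \<open>Bracket identities\<close>

context lie_pseudoalgebra
begin

lemma restrict_scalars_simps [simp]:
  "carrier (restrict_scalars A L) = carrier L"
  "add (restrict_scalars A L) = add L"
  "\<zero>\<^bsub>restrict_scalars A L\<^esub> = \<zero>\<^bsub>L\<^esub>"
  "r \<odot>\<^bsub>restrict_scalars A L\<^esub> X = (r \<odot>\<^bsub>A\<^esub> \<one>\<^bsub>A\<^esub>) \<odot>\<^bsub>L\<^esub> X"
  "a_inv (restrict_scalars A L) = a_inv L"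
  by (simp_all add: restrict_scalars_def a_inv_def m_inv_def fun_eq_iff)

lemma lie_br_closed [simp]:
  "\<lbrakk>X \<in> carrier L; Y \<in> carrier L\<rbrakk> \<Longrightarrow> lie_br L X Y \<in> carrier L"
  using br_closed by simp

lemma anchor_closed [simp]:
  "\<lbrakk>X \<in> carrier L; f \<in> carrier A\<rbrakk> \<Longrightarrow> anchor L X f \<in> carrier A"
  using anchor_derivation[of X] by (auto simp: derivations_def)

lemma anchor_mult:
  "\<lbrakk>X \<in> carrier L; f \<in> carrier A; g \<in> carrier A\<rbrakk>
    \<Longrightarrow> anchor L X (f \<otimes>\<^bsub>A\<^esub> g) = anchor L X f \<otimes>\<^bsub>A\<^esub> g \<oplus>\<^bsub>A\<^esub> f \<otimes>\<^bsub>A\<^esub> anchor L X g"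
  using anchor_derivation by (auto simp: derivations_def)

lemma lie_br_antisym:
  assumes X: "X \<in> carrier L" and Y: "Y \<in> carrier L"
  shows "lie_br L X Y = \<ominus>\<^bsub>L\<^esub> lie_br L Y X"
proof -
  have "lie_br L (X \<oplus>\<^bsub>L\<^esub> Y) (X \<oplus>\<^bsub>L\<^esub> Y) = \<zero>\<^bsub>L\<^esub>"
    using br_alternating X Y by simp
  moreover have "lie_br L (X \<oplus>\<^bsub>L\<^esub> Y) (X \<oplus>\<^bsub>L\<^esub> Y) = lie_br L X Y \<oplus>\<^bsub>L\<^esub> lie_br L Y X"
    using br_alternating[of X] br_alternating[of Y] br_add_left[of X Y "X \<oplus>\<^bsub>L\<^esub> Y"]
      br_add_right[of X X Y] br_add_right[of Y X Y] X Y
    by simp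
  ultimately have "lie_br L X Y \<oplus>\<^bsub>L\<^esub> lie_br L Y X = \<zero>\<^bsub>L\<^esub>" by simp
  then show ?thesis using X Y L.M.minus_equality by auto
qed

lemma lie_br_smult_left:
  assumes X: "X \<in> carrier L" and Y: "Y \<in> carrier L" and f: "f \<in> carrier A"
  shows "lie_br L (f \<odot>\<^bsub>L\<^esub> X) Y = f \<odot>\<^bsub>L\<^esub> lie_br L X Y \<ominus>\<^bsub>L\<^esub> anchor L Y f \<odot>\<^bsub>L\<^esub> X"
proof -
  have "lie_br L (f \<odot>\<^bsub>L\<^esub> X) Y = \<ominus>\<^bsub>L\<^esub> (f \<odot>\<^bsub>L\<^esub> lie_br L Y X \<oplus>\<^bsub>L\<^esub> anchor L Y f \<odot>\<^bsub>L\<^esub> X)"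
    using lie_br_antisym[of "f \<odot>\<^bsub>L\<^esub> X" Y] lie_br_leibniz X Y f by simp
  also have "\<dots> = f \<odot>\<^bsub>L\<^esub> lie_br L X Y \<ominus>\<^bsub>L\<^esub> anchor L Y f \<odot>\<^bsub>L\<^esub> X"
    using X Y f lie_br_antisym[OF X Y]
    by (simp add: L.M.minus_add a_minus_def L.smult_r_minus)
  finally show ?thesis .
qed

lemma smult_smult_commute:
  "\<lbrakk>f \<in> carrier A; g \<in> carrier A; X \<in> carrier L\<rbrakk>
    \<Longrightarrow> f \<odot>\<^bsub>L\<^esub> (g \<odot>\<^bsub>L\<^esub> X) = g \<odot>\<^bsub>L\<^esub> (f \<odot>\<^bsub>L\<^esub> X)"
  by (metis L.smult_assoc1 m_comm)

lemma smult_minus_left: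
  "\<lbrakk>f \<in> carrier A; g \<in> carrier A; X \<in> carrier L\<rbrakk>
    \<Longrightarrow> (f \<ominus>\<^bsub>A\<^esub> g) \<odot>\<^bsub>L\<^esub> X = f \<odot>\<^bsub>L\<^esub> X \<ominus>\<^bsub>L\<^esub> g \<odot>\<^bsub>L\<^esub> X"
  by (simp add: a_minus_def L.smult_l_distr L.smult_l_minus)

lemma lie_br_smult_smult:
  assumes X: "X \<in> carrier L" and Y: "Y \<in> carrier L" and f: "f \<in> carrier A" and g: "g \<in> carrier A"
  shows "lie_br L (g \<odot>\<^bsub>L\<^esub> X) (f \<odot>\<^bsub>L\<^esub> Y)
    = (g \<otimes>\<^bsub>A\<^esub> f) \<odot>\<^bsub>L\<^esub> lie_br L X Y \<oplus>\<^bsub>L\<^esub> (g \<otimes>\<^bsub>A\<^esub> anchor L X f) \<odot>\<^bsub>L\<^esub> Y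
      \<ominus>\<^bsub>L\<^esub> (f \<otimes>\<^bsub>A\<^esub> anchor L Y g) \<odot>\<^bsub>L\<^esub> X"
  using assms
  by (simp add: lie_br_smult_left lie_br_leibniz anchor_smult L.smult_r_distr L.smult_assoc1
      L.smult_r_minus a_minus_def L.M.a_ac smult_smult_commute)

lemma lie_br_minus_right:
  "\<lbrakk>X \<in> carrier L; Y \<in> carrier L; Z \<in> carrier L\<rbrakk>
    \<Longrightarrow> lie_br L X (Y \<ominus>\<^bsub>L\<^esub> Z) = lie_br L X Y \<ominus>\<^bsub>L\<^esub> lie_br L X Z"
proof -
  assume XYZ: "X \<in> carrier L" "Y \<in> carrier L" "Z \<in> carrier L"
  then have "lie_br L X (Y \<ominus>\<^bsub>L\<^esub> Z) \<oplus>\<^bsub>L\<^esub> lie_br L X Z = lie_br L X ((Y \<ominus>\<^bsub>L\<^esub> Z) \<oplus>\<^bsub>L\<^esub> Z)"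
    using br_add_right[of X "Y \<ominus>\<^bsub>L\<^esub> Z" Z] by simp
  also have "(Y \<ominus>\<^bsub>L\<^esub> Z) \<oplus>\<^bsub>L\<^esub> Z = Y"
    using XYZ by (simp add: a_minus_def L.M.a_assoc L.M.l_neg)
  finally show ?thesis
    using XYZ by (metis L.M.add.inv_solve_right L.M.minus_closed a_minus_def lie_br_closed)
qed

text \<open>
  Expanded by the Leibniz rules, all three brackets are combinations of \<open>[X, [X, Y]]\<close>, \<open>[X, Y]\<close> and
  \<open>X\<close>. The first two cancel, and \<open>X\<close> is left with a coefficient containing only first derivatives:
  the second derivatives \<open>X(Y(f))\<close> and \<open>Y(X(f))\<close> are absorbed by \<open>[X, Y](f)\<close>.
\<close>

lemma iterated_lie_br_identity:
  assumes X: "X \<in> carrier L" and Y: "Y \<in> carrier L" and f: "f \<in> carrier A" and g: "g \<in> carrier A"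
  shows "lie_br L (g \<odot>\<^bsub>L\<^esub> X) (lie_br L (f \<odot>\<^bsub>L\<^esub> X) Y)
    = lie_br L ((f \<otimes>\<^bsub>A\<^esub> g) \<odot>\<^bsub>L\<^esub> X) (lie_br L X Y)
      \<oplus>\<^bsub>L\<^esub> lie_br L ((g \<otimes>\<^bsub>A\<^esub> anchor L X f) \<odot>\<^bsub>L\<^esub> X) Y
      \<oplus>\<^bsub>L\<^esub> (anchor L Y f \<otimes>\<^bsub>A\<^esub> anchor L X g \<oplus>\<^bsub>A\<^esub> anchor L Y g \<otimes>\<^bsub>A\<^esub> anchor L X f) \<odot>\<^bsub>L\<^esub> X"
proof -
  define U where "U = lie_br L X Y"
  define V where "V = lie_br L X U"
  define a where "a = anchor L Y f"
  define b where "b = anchor L Y g"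
  define c where "c = anchor L X f"
  define d where "d = anchor L X g"
  have UV [simp]: "U \<in> carrier L" "V \<in> carrier L" using X Y by (simp_all add: U_def V_def)
  have abcd [simp]: "a \<in> carrier A" "b \<in> carrier A" "c \<in> carrier A" "d \<in> carrier A"
    using X Y f g by (simp_all add: a_def b_def c_def d_def)
  have Uf: "anchor L U f = anchor L X a \<ominus>\<^bsub>A\<^esub> anchor L Y c"
    using anchor_lie_br[OF X Y f] by (simp add: U_def a_def c_def)
  have [simp]: "anchor L X a \<in> carrier A" "anchor L Y c \<in> carrier A" "anchor L U g \<in> carrier A"
    using X Y g by simp_all
  note XY [simp] = X Y f g
  let ?r1 = "(a \<otimes>\<^bsub>A\<^esub> d) \<ominus>\<^bsub>A\<^esub> f \<otimes>\<^bsub>A\<^esub> anchor L U g \<ominus>\<^bsub>A\<^esub> g \<otimes>\<^bsub>A\<^esub> anchor L X a"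
  let ?r2 = "\<ominus>\<^bsub>A\<^esub> (anchor L U f \<otimes>\<^bsub>A\<^esub> g \<oplus>\<^bsub>A\<^esub> f \<otimes>\<^bsub>A\<^esub> anchor L U g)"
  let ?r3 = "\<ominus>\<^bsub>A\<^esub> (b \<otimes>\<^bsub>A\<^esub> c \<oplus>\<^bsub>A\<^esub> g \<otimes>\<^bsub>A\<^esub> anchor L Y c)"
  have "lie_br L (g \<odot>\<^bsub>L\<^esub> X) (lie_br L (f \<odot>\<^bsub>L\<^esub> X) Y)
      = lie_br L (g \<odot>\<^bsub>L\<^esub> X) (f \<odot>\<^bsub>L\<^esub> U) \<ominus>\<^bsub>L\<^esub> lie_br L (g \<odot>\<^bsub>L\<^esub> X) (a \<odot>\<^bsub>L\<^esub> X)"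
    by (simp add: lie_br_smult_left lie_br_minus_right U_def a_def)
  also have "\<dots> = (f \<otimes>\<^bsub>A\<^esub> g) \<odot>\<^bsub>L\<^esub> V \<oplus>\<^bsub>L\<^esub> (g \<otimes>\<^bsub>A\<^esub> c) \<odot>\<^bsub>L\<^esub> U \<oplus>\<^bsub>L\<^esub> ?r1 \<odot>\<^bsub>L\<^esub> X"
    using br_alternating[of X]
    by (simp add: lie_br_smult_smult U_def[symmetric] V_def[symmetric] c_def[symmetric] d_def[symmetric]
        a_minus_def L.smult_l_distr L.smult_l_minus L.M.minus_add L.M.a_ac m_comm)
  also have "?r1 = ?r2 \<oplus>\<^bsub>A\<^esub> ?r3 \<oplus>\<^bsub>A\<^esub> (a \<otimes>\<^bsub>A\<^esub> d \<oplus>\<^bsub>A\<^esub> b \<otimes>\<^bsub>A\<^esub> c)"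
    unfolding Uf by (intro iterated_bracket_coefficient) simp_all
  also have "(f \<otimes>\<^bsub>A\<^esub> g) \<odot>\<^bsub>L\<^esub> V \<oplus>\<^bsub>L\<^esub> (g \<otimes>\<^bsub>A\<^esub> c) \<odot>\<^bsub>L\<^esub> U
        \<oplus>\<^bsub>L\<^esub> (?r2 \<oplus>\<^bsub>A\<^esub> ?r3 \<oplus>\<^bsub>A\<^esub> (a \<otimes>\<^bsub>A\<^esub> d \<oplus>\<^bsub>A\<^esub> b \<otimes>\<^bsub>A\<^esub> c)) \<odot>\<^bsub>L\<^esub> X
      = ((f \<otimes>\<^bsub>A\<^esub> g) \<odot>\<^bsub>L\<^esub> V \<oplus>\<^bsub>L\<^esub> ?r2 \<odot>\<^bsub>L\<^esub> X) \<oplus>\<^bsub>L\<^esub> ((g \<otimes>\<^bsub>A\<^esub> c) \<odot>\<^bsub>L\<^esub> U \<oplus>\<^bsub>L\<^esub> ?r3 \<odot>\<^bsub>L\<^esub> X)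
        \<oplus>\<^bsub>L\<^esub> (a \<otimes>\<^bsub>A\<^esub> d \<oplus>\<^bsub>A\<^esub> b \<otimes>\<^bsub>A\<^esub> c) \<odot>\<^bsub>L\<^esub> X"
    by (simp add: L.smult_l_distr L.M.a_ac)
  also have "(f \<otimes>\<^bsub>A\<^esub> g) \<odot>\<^bsub>L\<^esub> V \<oplus>\<^bsub>L\<^esub> ?r2 \<odot>\<^bsub>L\<^esub> X = lie_br L ((f \<otimes>\<^bsub>A\<^esub> g) \<odot>\<^bsub>L\<^esub> X) U"
    by (simp add: lie_br_smult_left anchor_mult V_def a_minus_def L.smult_l_minus)
  also have "(g \<otimes>\<^bsub>A\<^esub> c) \<odot>\<^bsub>L\<^esub> U \<oplus>\<^bsub>L\<^esub> ?r3 \<odot>\<^bsub>L\<^esub> X = lie_br L ((g \<otimes>\<^bsub>A\<^esub> c) \<odot>\<^bsub>L\<^esub> X) Y"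
    by (simp add: lie_br_smult_left anchor_mult U_def b_def a_minus_def L.smult_l_minus)
  finally show ?thesis by (simp only: U_def a_def b_def c_def d_def)
qed

text \<open>
  Both brackets contain the term \<open>k [Y, h X]\<close>, and only derivatives of \<open>k\<close> survive.
\<close>

lemma lie_br_smult_difference:
  assumes X: "X \<in> carrier L" and Y: "Y \<in> carrier L" and k: "k \<in> carrier A" and h: "h \<in> carrier A"
  shows "lie_br L Y (k \<odot>\<^bsub>L\<^esub> (h \<odot>\<^bsub>L\<^esub> X)) \<ominus>\<^bsub>L\<^esub> lie_br L (k \<odot>\<^bsub>L\<^esub> Y) (h \<odot>\<^bsub>L\<^esub> X)
    = (anchor L Y k \<otimes>\<^bsub>A\<^esub> h) \<odot>\<^bsub>L\<^esub> X \<oplus>\<^bsub>L\<^esub> (anchor L X k \<otimes>\<^bsub>A\<^esub> h) \<odot>\<^bsub>L\<^esub> Y"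
proof -
  note [simp] = assms
  let ?P = "k \<odot>\<^bsub>L\<^esub> lie_br L Y (h \<odot>\<^bsub>L\<^esub> X)"
  have "lie_br L Y (k \<odot>\<^bsub>L\<^esub> (h \<odot>\<^bsub>L\<^esub> X)) = ?P \<oplus>\<^bsub>L\<^esub> (anchor L Y k \<otimes>\<^bsub>A\<^esub> h) \<odot>\<^bsub>L\<^esub> X"
    by (simp add: lie_br_leibniz L.smult_assoc1)
  moreover have "lie_br L (k \<odot>\<^bsub>L\<^esub> Y) (h \<odot>\<^bsub>L\<^esub> X) = ?P \<ominus>\<^bsub>L\<^esub> (anchor L X k \<otimes>\<^bsub>A\<^esub> h) \<odot>\<^bsub>L\<^esub> Y"
    by (simp add: lie_br_smult_left anchor_smult m_comm)
  ultimately show ?thesis by (simp add: L.M.add_diff_diff_cancel_left)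
qed

section \<open>The modular core and the multiplier ideal\<close>

text \<open>
  For an \<open>R\<close>-submodule \<open>K\<close> of \<open>L\<close>, this is the largest \<open>A\<close>-submodule contained in \<open>K\<close>.
\<close>

definition "modular_core K = {Z \<in> carrier L. \<forall>h\<in>carrier A. h \<odot>\<^bsub>L\<^esub> Z \<in> K}"

text \<open>
  For an \<open>R\<close>-submodule \<open>K\<close> of \<open>L\<close>, this is the largest ideal \<open>I\<close> of \<open>A\<close> with \<open>I L \<subseteq> K\<close>.
\<close>

definition "multiplier_ideal K = {h \<in> carrier A. \<forall>Z\<in>carrier L. h \<odot>\<^bsub>L\<^esub> Z \<in> K}"

lemma restricted_submoduleD:
  assumes "submodule K R (restrict_scalars A L)"
  shows "K \<subseteq> carrier L" "\<zero>\<^bsub>L\<^esub> \<in> K"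
    "\<And>X. X \<in> K \<Longrightarrow> \<ominus>\<^bsub>L\<^esub> X \<in> K" "\<And>X Y. \<lbrakk>X \<in> K; Y \<in> K\<rbrakk> \<Longrightarrow> X \<oplus>\<^bsub>L\<^esub> Y \<in> K"
    "\<And>X Y. \<lbrakk>X \<in> K; Y \<in> K\<rbrakk> \<Longrightarrow> X \<ominus>\<^bsub>L\<^esub> Y \<in> K"
    "\<And>r X. \<lbrakk>r \<in> carrier R; X \<in> K\<rbrakk> \<Longrightarrow> (r \<odot>\<^bsub>A\<^esub> \<one>\<^bsub>A\<^esub>) \<odot>\<^bsub>L\<^esub> X \<in> K"
  using submoduleE[OF assms] subgroup.one_closed[OF submodule.axioms(1)[OF assms]]
  by (auto simp: a_minus_def)

lemma restricted_submoduleI: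
  assumes "K \<subseteq> carrier L" "\<zero>\<^bsub>L\<^esub> \<in> K"
    "\<And>X. X \<in> K \<Longrightarrow> \<ominus>\<^bsub>L\<^esub> X \<in> K" "\<And>X Y. \<lbrakk>X \<in> K; Y \<in> K\<rbrakk> \<Longrightarrow> X \<oplus>\<^bsub>L\<^esub> Y \<in> K"
    "\<And>r X. \<lbrakk>r \<in> carrier R; X \<in> K\<rbrakk> \<Longrightarrow> (r \<odot>\<^bsub>A\<^esub> \<one>\<^bsub>A\<^esub>) \<odot>\<^bsub>L\<^esub> X \<in> K"
  shows "submodule K R (restrict_scalars A L)"
  using assms by (intro submoduleI) auto

lemma restricted_submodule_if_modular:
  assumes "submodule K A L"
  shows "submodule K R (restrict_scalars A L)"
  using L.submoduleE[OF assms] subgroup.one_closed[OF submodule.axioms(1)[OF assms]]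
  by (intro restricted_submoduleI) auto

lemma submodule_modular_core:
  assumes K: "submodule K R (restrict_scalars A L)"
  shows "submodule (modular_core K) A L"
  using restricted_submoduleD[OF K]
  by (intro L.submoduleI) (auto simp: modular_core_def L.smult_r_distr L.smult_r_minus
      L.smult_assoc1[symmetric])

lemma modular_core_subset:
  "modular_core K \<subseteq> K"
  unfolding modular_core_def by (metis (mono_tags, lifting) one_closed L.smult_one mem_Collect_eq subsetI)

lemma ideal_multiplier_ideal:
  assumes K: "submodule K R (restrict_scalars A L)"
  shows "ideal (multiplier_ideal K) A"
  using restricted_submoduleD[OF K]
  by (intro idealI_commutative)
    (auto simp: multiplier_ideal_def L.smult_l_distr L.smult_assoc1 m_comm)

lemma halve_mem_submodule:
  assumes two: "\<one>\<^bsub>R\<^esub> \<oplus>\<^bsub>R\<^esub> \<one>\<^bsub>R\<^esub> \<in> Units R" and K: "submodule K R (restrict_scalars A L)"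
    and X: "X \<in> carrier L" "X \<oplus>\<^bsub>L\<^esub> X \<in> K"
  shows "X \<in> K"
proof -
  obtain r where r: "r \<in> carrier R" "r \<odot>\<^bsub>A\<^esub> \<one>\<^bsub>A\<^esub> \<oplus>\<^bsub>A\<^esub> r \<odot>\<^bsub>A\<^esub> \<one>\<^bsub>A\<^esub> = \<one>\<^bsub>A\<^esub>"
    using obtain_half[OF two] .
  have h: "r \<odot>\<^bsub>A\<^esub> \<one>\<^bsub>A\<^esub> \<in> carrier A"
    using r(1) module.smult_closed[OF algebra.module[OF algebra_axioms]] by simp
  have "(r \<odot>\<^bsub>A\<^esub> \<one>\<^bsub>A\<^esub>) \<odot>\<^bsub>L\<^esub> (X \<oplus>\<^bsub>L\<^esub> X) = X"
    using L.smult_l_distr[OF h h X(1)] L.smult_r_distr[OF h X(1) X(1)] r(2) X(1) by simp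
  then show ?thesis using restricted_submoduleD(6)[OF K r(1) X(2)] by simp
qed

text \<open>
  The form in which strong non-singularity enters all three main arguments. Squares suffice because
  \<open>\<one>\<close> is a linear combination of the elements \<open>X(k)\<close>, which are nilpotent modulo \<open>J\<close>.
\<close>

lemma one_mem_ideal_if_anchor_squares:
  assumes ns: "strongly_nonsingular R A L" and J: "ideal J A"
    and sq: "\<And>X k. \<lbrakk>X \<in> carrier L; k \<in> carrier A\<rbrakk> \<Longrightarrow> anchor L X k \<otimes>\<^bsub>A\<^esub> anchor L X k \<in> J"
  shows "\<one>\<^bsub>A\<^esub> \<in> J"
  using ns sq
  by (intro one_mem_ideal_if_squares_of_generators[OF J,
        of "{anchor L X f |X f. X \<in> carrier L \<and> f \<in> carrier A}"])
    (auto simp: strongly_nonsingular_def anchor_image_span_def)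

context
  fixes K assumes K: "lie_ideal R A L K"
begin

lemma lie_ideal_submodule: "submodule K R (restrict_scalars A L)"
  using K by (simp add: lie_ideal_def)

lemmas lie_ideal_closed = restricted_submoduleD[OF lie_ideal_submodule]

lemma lie_ideal_carrier: "X \<in> K \<Longrightarrow> X \<in> carrier L" using lie_ideal_closed(1) by blast

lemma lie_ideal_br: "\<lbrakk>X \<in> carrier L; Y \<in> K\<rbrakk> \<Longrightarrow> lie_br L X Y \<in> K"
  using K by (simp add: lie_ideal_def)

lemma anchor_invariant_multiplier_ideal: "anchor_invariant L (multiplier_ideal K)"
  unfolding anchor_invariant_def multiplier_ideal_def
proof (intro ballI CollectI conjI)
  fix X h Z
  assume X: "X \<in> carrier L" and h: "h \<in> {h \<in> carrier A. \<forall>Z\<in>carrier L. h \<odot>\<^bsub>L\<^esub> Z \<in> K}"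
    and Z: "Z \<in> carrier L"
  then have hA: "h \<in> carrier A" and hK: "\<And>Z. Z \<in> carrier L \<Longrightarrow> h \<odot>\<^bsub>L\<^esub> Z \<in> K" by auto
  show "anchor L X h \<in> carrier A" using X hA by simp
  have "lie_br L X (h \<odot>\<^bsub>L\<^esub> Z) \<ominus>\<^bsub>L\<^esub> h \<odot>\<^bsub>L\<^esub> lie_br L X Z \<in> K"
    using X Z hK lie_ideal_br by (intro lie_ideal_closed(5)) auto
  moreover have "lie_br L X (h \<odot>\<^bsub>L\<^esub> Z) \<ominus>\<^bsub>L\<^esub> h \<odot>\<^bsub>L\<^esub> lie_br L X Z = anchor L X h \<odot>\<^bsub>L\<^esub> Z"
    using X Z hA by (simp add: lie_br_leibniz L.M.add_diff_cancel_left)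
  ultimately show "anchor L X h \<odot>\<^bsub>L\<^esub> Z \<in> K" by simp
qed

text \<open>
  In \<open>Z(l) W = [W, l Z] - [l W, Z] - W(l) Z\<close> each term on the right is a multiple of \<open>Z\<close> or a bracket
  with one, hence in \<open>K\<close>.
\<close>

lemma anchor_modular_core_mem:
  assumes Z: "Z \<in> modular_core K" and l: "l \<in> carrier A"
  shows "anchor L Z l \<in> multiplier_ideal K"
proof -
  have ZL: "Z \<in> carrier L" and ZK: "\<And>h. h \<in> carrier A \<Longrightarrow> h \<odot>\<^bsub>L\<^esub> Z \<in> K"
    using Z by (auto simp: modular_core_def)
  have "anchor L Z l \<odot>\<^bsub>L\<^esub> W \<in> K" if W: "W \<in> carrier L" for W
  proof -
    have "lie_br L W (l \<odot>\<^bsub>L\<^esub> Z) \<ominus>\<^bsub>L\<^esub> lie_br L (l \<odot>\<^bsub>L\<^esub> W) Z \<ominus>\<^bsub>L\<^esub> anchor L W l \<odot>\<^bsub>L\<^esub> Z \<in> K"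
      using W l ZK[of l] ZK[of "anchor L W l"] ZK[of "\<one>\<^bsub>A\<^esub>"] ZL
      by (intro lie_ideal_closed(5) lie_ideal_br) auto
    moreover have "lie_br L W (l \<odot>\<^bsub>L\<^esub> Z) \<ominus>\<^bsub>L\<^esub> lie_br L (l \<odot>\<^bsub>L\<^esub> W) Z \<ominus>\<^bsub>L\<^esub> anchor L W l \<odot>\<^bsub>L\<^esub> Z
        = anchor L Z l \<odot>\<^bsub>L\<^esub> W"
      using W l ZL
      by (simp add: lie_br_leibniz lie_br_smult_left L.M.add_diff_diff_cancel_left
          L.M.add_diff_cancel_left)
    ultimately show ?thesis by simp
  qed
  then show ?thesis using ZL l by (simp add: multiplier_ideal_def)
qed

section \<open>Anchors of a Lie ideal\<close>

lemma symmetric_product_smult_mem: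
  assumes X: "X \<in> carrier L" and Y: "Y \<in> K" and f: "f \<in> carrier A" and g: "g \<in> carrier A"
  shows "(anchor L Y f \<otimes>\<^bsub>A\<^esub> anchor L X g \<oplus>\<^bsub>A\<^esub> anchor L Y g \<otimes>\<^bsub>A\<^esub> anchor L X f) \<odot>\<^bsub>L\<^esub> X \<in> K"
    (is "?P \<odot>\<^bsub>L\<^esub> X \<in> K")
proof -
  note YL = lie_ideal_carrier[OF Y]
  let ?S = "lie_br L ((f \<otimes>\<^bsub>A\<^esub> g) \<odot>\<^bsub>L\<^esub> X) (lie_br L X Y)
      \<oplus>\<^bsub>L\<^esub> lie_br L ((g \<otimes>\<^bsub>A\<^esub> anchor L X f) \<odot>\<^bsub>L\<^esub> X) Y"
  have S: "?S \<in> K" using X Y f g by (intro lie_ideal_closed(4) lie_ideal_br) auto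
  have B: "lie_br L (g \<odot>\<^bsub>L\<^esub> X) (lie_br L (f \<odot>\<^bsub>L\<^esub> X) Y) \<in> K"
    using X Y f g by (intro lie_ideal_br) auto
  have "(?S \<oplus>\<^bsub>L\<^esub> ?P \<odot>\<^bsub>L\<^esub> X) \<ominus>\<^bsub>L\<^esub> ?S = ?P \<odot>\<^bsub>L\<^esub> X"
    using X YL f g lie_ideal_carrier[OF S] by (intro L.M.add_diff_cancel_left) auto
  then show ?thesis
    using lie_ideal_closed(5)[OF B S] iterated_lie_br_identity[OF X YL f g] by simp
qed


text \<open>
  Linearity in \<open>t\<close> is recovered from the quadratic hypothesis by
  \<open>(1 + k)\<^sup>2 - k\<^sup>2 - 1 = 2 k\<close>.
\<close>

lemma smult_mem_modular_core_if_squares: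
  assumes two: "\<one>\<^bsub>R\<^esub> \<oplus>\<^bsub>R\<^esub> \<one>\<^bsub>R\<^esub> \<in> Units R"
    and p: "p \<in> carrier A" and X: "X \<in> carrier L"
    and sq: "\<And>t. t \<in> carrier A \<Longrightarrow> ((t \<otimes>\<^bsub>A\<^esub> t) \<otimes>\<^bsub>A\<^esub> p) \<odot>\<^bsub>L\<^esub> X \<in> K"
  shows "p \<odot>\<^bsub>L\<^esub> X \<in> modular_core K"
proof -
  have "k \<odot>\<^bsub>L\<^esub> (p \<odot>\<^bsub>L\<^esub> X) \<in> K" if k: "k \<in> carrier A" for k
  proof -
    let ?t = "\<one>\<^bsub>A\<^esub> \<oplus>\<^bsub>A\<^esub> k"
    let ?Q = "((?t \<otimes>\<^bsub>A\<^esub> ?t) \<otimes>\<^bsub>A\<^esub> p) \<odot>\<^bsub>L\<^esub> X \<ominus>\<^bsub>L\<^esub> ((k \<otimes>\<^bsub>A\<^esub> k) \<otimes>\<^bsub>A\<^esub> p) \<odot>\<^bsub>L\<^esub> X \<ominus>\<^bsub>L\<^esub> p \<odot>\<^bsub>L\<^esub> X"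
    have Q: "?Q \<in> K"
      using sq[of ?t] sq[of k] sq[of "\<one>\<^bsub>A\<^esub>"] k p by (intro lie_ideal_closed(5)) auto
    have "?Q = ((?t \<otimes>\<^bsub>A\<^esub> ?t) \<otimes>\<^bsub>A\<^esub> p \<ominus>\<^bsub>A\<^esub> (k \<otimes>\<^bsub>A\<^esub> k) \<otimes>\<^bsub>A\<^esub> p \<ominus>\<^bsub>A\<^esub> p) \<odot>\<^bsub>L\<^esub> X"
      using k p X by (simp add: smult_minus_left)
    also have "\<dots> = (k \<otimes>\<^bsub>A\<^esub> p \<oplus>\<^bsub>A\<^esub> k \<otimes>\<^bsub>A\<^esub> p) \<odot>\<^bsub>L\<^esub> X"
      by (simp only: square_polarization[OF k p])
    also have "\<dots> = k \<odot>\<^bsub>L\<^esub> (p \<odot>\<^bsub>L\<^esub> X) \<oplus>\<^bsub>L\<^esub> k \<odot>\<^bsub>L\<^esub> (p \<odot>\<^bsub>L\<^esub> X)"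
      using k p X by (simp only: L.smult_l_distr L.smult_assoc1 m_closed)
    finally have eq: "?Q = k \<odot>\<^bsub>L\<^esub> (p \<odot>\<^bsub>L\<^esub> X) \<oplus>\<^bsub>L\<^esub> k \<odot>\<^bsub>L\<^esub> (p \<odot>\<^bsub>L\<^esub> X)" .
    have "k \<odot>\<^bsub>L\<^esub> (p \<odot>\<^bsub>L\<^esub> X) \<in> carrier L" using k p X by simp
    then show ?thesis
      using Q unfolding eq by (rule halve_mem_submodule[OF two lie_ideal_submodule])
  qed
  then show ?thesis using p X by (simp add: modular_core_def)
qed

text \<open>
  Replacing \<open>X\<close> by \<open>t X\<close> in \<open>symmetric_product_smult_mem\<close> scales the coefficient and the vector by
  \<open>t\<close> each.
\<close>

lemma symmetric_product_smult_mem_modular_core: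
  assumes two: "\<one>\<^bsub>R\<^esub> \<oplus>\<^bsub>R\<^esub> \<one>\<^bsub>R\<^esub> \<in> Units R"
    and X: "X \<in> carrier L" and Y: "Y \<in> K" and f: "f \<in> carrier A" and g: "g \<in> carrier A"
  shows "(anchor L Y f \<otimes>\<^bsub>A\<^esub> anchor L X g \<oplus>\<^bsub>A\<^esub> anchor L Y g \<otimes>\<^bsub>A\<^esub> anchor L X f) \<odot>\<^bsub>L\<^esub> X
    \<in> modular_core K"
proof (rule smult_mem_modular_core_if_squares[OF two _ X])
  define p where
    "p = anchor L Y f \<otimes>\<^bsub>A\<^esub> anchor L X g \<oplus>\<^bsub>A\<^esub> anchor L Y g \<otimes>\<^bsub>A\<^esub> anchor L X f"
  note YL = lie_ideal_carrier[OF Y]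
  show p: "p \<in> carrier A" using X YL f g by (simp add: p_def)
  fix t assume t: "t \<in> carrier A"
  have "anchor L Y f \<otimes>\<^bsub>A\<^esub> anchor L (t \<odot>\<^bsub>L\<^esub> X) g \<oplus>\<^bsub>A\<^esub> anchor L Y g \<otimes>\<^bsub>A\<^esub> anchor L (t \<odot>\<^bsub>L\<^esub> X) f
      = t \<otimes>\<^bsub>A\<^esub> p"
    using X YL f g t by (simp add: p_def anchor_smult r_distr m_lcomm)
  then have "(t \<otimes>\<^bsub>A\<^esub> p) \<odot>\<^bsub>L\<^esub> (t \<odot>\<^bsub>L\<^esub> X) \<in> K"
    using symmetric_product_smult_mem[of "t \<odot>\<^bsub>L\<^esub> X" Y f g] X Y f g t by simp
  moreover have "(t \<otimes>\<^bsub>A\<^esub> p) \<odot>\<^bsub>L\<^esub> (t \<odot>\<^bsub>L\<^esub> X) = ((t \<otimes>\<^bsub>A\<^esub> t) \<otimes>\<^bsub>A\<^esub> p) \<odot>\<^bsub>L\<^esub> X"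
    using L.smult_assoc1[of "t \<otimes>\<^bsub>A\<^esub> p" t X] X t p by (simp add: m_ac)
  ultimately show "((t \<otimes>\<^bsub>A\<^esub> t) \<otimes>\<^bsub>A\<^esub> p) \<odot>\<^bsub>L\<^esub> X \<in> K" by simp
qed

text \<open>
  Put \<open>T(f, g, l) = Y(f) X(g) X(l)\<close>. Modulo the multiplier ideal, \<open>T\<close> is antisymmetric in its first
  two arguments, so \<open>2 T(k, k, f)\<close> vanishes, hence so does \<open>T(k, k, f) = T(k, f, k) = - T(f, k, k)\<close>.
\<close>

lemma anchor_times_square_mem:
  assumes two: "\<one>\<^bsub>R\<^esub> \<oplus>\<^bsub>R\<^esub> \<one>\<^bsub>R\<^esub> \<in> Units R"
    and X: "X \<in> carrier L" and Y: "Y \<in> K" and f: "f \<in> carrier A" and k: "k \<in> carrier A"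
  shows "anchor L Y f \<otimes>\<^bsub>A\<^esub> (anchor L X k \<otimes>\<^bsub>A\<^esub> anchor L X k) \<in> multiplier_ideal K"
proof -
  interpret I: ideal "multiplier_ideal K" A by (rule ideal_multiplier_ideal[OF lie_ideal_submodule])
  note YL = lie_ideal_carrier[OF Y]
  have sym: "(anchor L Y f \<otimes>\<^bsub>A\<^esub> anchor L X g \<oplus>\<^bsub>A\<^esub> anchor L Y g \<otimes>\<^bsub>A\<^esub> anchor L X f) \<otimes>\<^bsub>A\<^esub> anchor L X l
      \<in> multiplier_ideal K"
    if "f \<in> carrier A" "g \<in> carrier A" "l \<in> carrier A" for f g l
    using anchor_modular_core_mem[OF symmetric_product_smult_mem_modular_core[OF two X Y that(1,2)] that(3)]
      X YL that by (simp add: anchor_smult)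
  define a b c d where "a = anchor L Y f" and "b = anchor L Y k"
    and "c = anchor L X f" and "d = anchor L X k"
  have abcd: "a \<in> carrier A" "b \<in> carrier A" "c \<in> carrier A" "d \<in> carrier A"
    using X YL f k by (simp_all add: a_def b_def c_def d_def)
  let ?s = "a \<otimes>\<^bsub>A\<^esub> (d \<otimes>\<^bsub>A\<^esub> d)" and ?t = "b \<otimes>\<^bsub>A\<^esub> (c \<otimes>\<^bsub>A\<^esub> d)"
  have st: "?s \<in> carrier A" "?t \<in> carrier A" using abcd by simp_all
  have "(b \<otimes>\<^bsub>A\<^esub> d \<oplus>\<^bsub>A\<^esub> b \<otimes>\<^bsub>A\<^esub> d) \<otimes>\<^bsub>A\<^esub> c = ?t \<oplus>\<^bsub>A\<^esub> ?t"
    using abcd by (simp add: l_distr m_assoc m_comm[of d c])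
  then have t: "?t \<in> multiplier_ideal K"
    using sym[OF k k f] halve_mem_ideal[OF two I.ideal_axioms st(2)] by (simp only: b_def c_def d_def)
  have "(a \<otimes>\<^bsub>A\<^esub> d \<oplus>\<^bsub>A\<^esub> b \<otimes>\<^bsub>A\<^esub> c) \<otimes>\<^bsub>A\<^esub> d = ?t \<oplus>\<^bsub>A\<^esub> ?s"
    using abcd st by (simp add: l_distr m_assoc abelian_monoid.a_comm[OF abelian_group.axioms(1)[OF ring.is_abelian_group[OF ring_axioms]]])
  then have ts: "?t \<oplus>\<^bsub>A\<^esub> ?s \<in> multiplier_ideal K"
    using sym[OF f k k] by (simp only: a_def b_def c_def d_def)
  have "(?t \<oplus>\<^bsub>A\<^esub> ?s) \<ominus>\<^bsub>A\<^esub> ?t \<in> multiplier_ideal K"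
    unfolding a_minus_def by (rule I.a_closed[OF ts I.a_inv_closed[OF t]])
  then have "?s \<in> multiplier_ideal K"
    by (simp only: abelian_group.add_diff_cancel_left[OF ring.is_abelian_group[OF ring_axioms] st(2,1)])
  then show ?thesis by (simp only: a_def d_def)
qed

lemma anchor_mem_multiplier_ideal:
  assumes two: "\<one>\<^bsub>R\<^esub> \<oplus>\<^bsub>R\<^esub> \<one>\<^bsub>R\<^esub> \<in> Units R" and ns: "strongly_nonsingular R A L"
    and Y: "Y \<in> K" and f: "f \<in> carrier A"
  shows "anchor L Y f \<in> multiplier_ideal K"
proof -
  interpret I: ideal "multiplier_ideal K" A by (rule ideal_multiplier_ideal[OF lie_ideal_submodule])
  define J where "J = {h \<in> carrier A. h \<otimes>\<^bsub>A\<^esub> anchor L Y f \<in> multiplier_ideal K}"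
  have Yf: "anchor L Y f \<in> carrier A" using lie_ideal_carrier[OF Y] f by simp
  have J: "ideal J A"
    using Yf by (intro idealI_commutative) (auto simp: J_def l_distr m_assoc I.I_l_closed)
  have "\<one>\<^bsub>A\<^esub> \<in> J"
  proof (rule one_mem_ideal_if_anchor_squares[OF ns J])
    fix X k assume "X \<in> carrier L" "k \<in> carrier A"
    then show "anchor L X k \<otimes>\<^bsub>A\<^esub> anchor L X k \<in> J"
      using anchor_times_square_mem[OF two _ Y f] Yf by (simp add: J_def m_comm)
  qed
  then show ?thesis using Yf by (simp add: J_def)
qed

section \<open>The commutator ideal\<close>

lemma lie_br_mem_lie_br_span:
  "\<lbrakk>X \<in> carrier L; Y \<in> K\<rbrakk> \<Longrightarrow> lie_br L X Y \<in> lie_br_span R A L (carrier L) K"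
  unfolding lie_br_span_def by (rule subsetD[OF module_span_superset]) auto

lemma submodule_lie_br_span:
  "submodule (lie_br_span R A L (carrier L) K) R (restrict_scalars A L)"
  unfolding lie_br_span_def using lie_ideal_carrier by (intro submodule_module_span) auto

lemma lie_br_span_least:
  assumes "submodule N R (restrict_scalars A L)"
    and "\<And>X Y. \<lbrakk>X \<in> carrier L; Y \<in> K\<rbrakk> \<Longrightarrow> lie_br L X Y \<in> N"
  shows "lie_br_span R A L (carrier L) K \<subseteq> N"
  unfolding lie_br_span_def using assms by (intro module_span_least) auto

lemma lie_br_span_subset: "lie_br_span R A L (carrier L) K \<subseteq> K"
  by (rule lie_br_span_least[OF lie_ideal_submodule lie_ideal_br])

lemma lie_ideal_lie_br_span: "lie_ideal R A L (lie_br_span R A L (carrier L) K)"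
  unfolding lie_ideal_def
  using submodule_lie_br_span by (auto intro!: lie_br_mem_lie_br_span subsetD[OF lie_br_span_subset])

text \<open>
  Modulo \<open>[L, K]\<close>, the vector \<open>Y(k) h X\<close> changes sign under \<open>X \<leftrightarrow> Y\<close> for every multiplier \<open>h\<close>, since
  \<open>h X\<close> and \<open>k h X\<close> lie in \<open>K\<close>; so \<open>X(k) h X\<close> vanishes. With \<open>X(k) h\<close> and \<open>Z(k) h\<close> as multipliers,
  \<open>X(k)\<^sup>2 h Z\<close> becomes \<open>- Z(k) X(k) h X\<close>, which vanishes.
\<close>

lemma multiplier_ideal_smult_mem_lie_br_span:
  assumes two: "\<one>\<^bsub>R\<^esub> \<oplus>\<^bsub>R\<^esub> \<one>\<^bsub>R\<^esub> \<in> Units R" and ns: "strongly_nonsingular R A L"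
    and h: "h \<in> multiplier_ideal K" and Z: "Z \<in> carrier L"
  shows "h \<odot>\<^bsub>L\<^esub> Z \<in> lie_br_span R A L (carrier L) K" (is "_ \<in> ?N")
proof -
  interpret I: ideal "multiplier_ideal K" A by (rule ideal_multiplier_ideal[OF lie_ideal_submodule])
  note N = restricted_submoduleD[OF submodule_lie_br_span]
  have IK: "h \<odot>\<^bsub>L\<^esub> X \<in> K" if "h \<in> multiplier_ideal K" "X \<in> carrier L" for h X
    using that unfolding multiplier_ideal_def by blast
  have swap: "(anchor L Y k \<otimes>\<^bsub>A\<^esub> h) \<odot>\<^bsub>L\<^esub> X \<oplus>\<^bsub>L\<^esub> (anchor L X k \<otimes>\<^bsub>A\<^esub> h) \<odot>\<^bsub>L\<^esub> Y \<in> ?N"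
    if X: "X \<in> carrier L" and Y: "Y \<in> carrier L" and k: "k \<in> carrier A"
      and h: "h \<in> multiplier_ideal K" for X Y k h
  proof -
    have "lie_br L Y (k \<odot>\<^bsub>L\<^esub> (h \<odot>\<^bsub>L\<^esub> X)) \<in> ?N"
      using IK[OF I.I_l_closed[OF h k] X] unfolding L.smult_assoc1[OF k I.Icarr[OF h] X]
      by (rule lie_br_mem_lie_br_span[OF Y])
    moreover have "lie_br L (k \<odot>\<^bsub>L\<^esub> Y) (h \<odot>\<^bsub>L\<^esub> X) \<in> ?N"
      using IK[OF h X] by (rule lie_br_mem_lie_br_span[OF L.smult_closed[OF k Y]])
    ultimately show ?thesis
      unfolding lie_br_smult_difference[OF X Y k I.Icarr[OF h], symmetric] by (rule N(5))
  qed
  have diag: "(anchor L X k \<otimes>\<^bsub>A\<^esub> h) \<odot>\<^bsub>L\<^esub> X \<in> ?N"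
    if X: "X \<in> carrier L" and k: "k \<in> carrier A" and h: "h \<in> multiplier_ideal K" for X k h
    using X k I.Icarr[OF h]
    by (intro halve_mem_submodule[OF two submodule_lie_br_span _ swap[OF X X k h]]) simp
  \<comment> \<open>Quantifying over all multipliers \<open>h\<close> is what makes \<open>J\<close> an ideal: a factor \<open>b \<in> A\<close> moves into \<open>h\<close>,
    while \<open>[L, K]\<close> itself is so far only closed under scalars from \<open>R\<close>.\<close>
  define J where "J = {a \<in> carrier A. \<forall>h\<in>multiplier_ideal K. \<forall>Z\<in>carrier L. (a \<otimes>\<^bsub>A\<^esub> h) \<odot>\<^bsub>L\<^esub> Z \<in> ?N}"
  have J: "ideal J A"
  proof (rule idealI_commutative)
    show "b \<otimes>\<^bsub>A\<^esub> a \<in> J" if a: "a \<in> J" and b: "b \<in> carrier A" for a b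
    proof -
      have "((b \<otimes>\<^bsub>A\<^esub> a) \<otimes>\<^bsub>A\<^esub> h) \<odot>\<^bsub>L\<^esub> Z \<in> ?N" if h: "h \<in> multiplier_ideal K" and Z: "Z \<in> carrier L" for h Z
      proof -
        have "(a \<otimes>\<^bsub>A\<^esub> (b \<otimes>\<^bsub>A\<^esub> h)) \<odot>\<^bsub>L\<^esub> Z \<in> ?N" using a I.I_l_closed[OF h b] Z by (simp add: J_def)
        then show ?thesis using a b I.Icarr[OF h] by (simp add: J_def m_ac)
      qed
      then show ?thesis using a b by (simp add: J_def)
    qed
    show "a \<oplus>\<^bsub>A\<^esub> b \<in> J" if a: "a \<in> J" and b: "b \<in> J" for a b
      using a b N(4) by (simp add: J_def l_distr L.smult_l_distr I.Icarr)
    show "\<zero>\<^bsub>A\<^esub> \<in> J" using N(2) by (simp add: J_def I.Icarr)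
  qed (simp add: J_def)
  have "\<one>\<^bsub>A\<^esub> \<in> J"
  proof (rule one_mem_ideal_if_anchor_squares[OF ns J])
    fix X k assume X: "X \<in> carrier L" and k: "k \<in> carrier A"
    let ?s = "anchor L X k"
    have "((?s \<otimes>\<^bsub>A\<^esub> ?s) \<otimes>\<^bsub>A\<^esub> h) \<odot>\<^bsub>L\<^esub> Z \<in> ?N" if h: "h \<in> multiplier_ideal K" and Z: "Z \<in> carrier L" for h Z
    proof -
      have s: "?s \<in> carrier A" and z: "anchor L Z k \<in> carrier A" using X Z k by auto
      note hA = I.Icarr[OF h]
      let ?u = "(?s \<otimes>\<^bsub>A\<^esub> (?s \<otimes>\<^bsub>A\<^esub> h)) \<odot>\<^bsub>L\<^esub> Z" and ?v = "(anchor L Z k \<otimes>\<^bsub>A\<^esub> (?s \<otimes>\<^bsub>A\<^esub> h)) \<odot>\<^bsub>L\<^esub> X"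
      have uv: "?u \<in> carrier L" "?v \<in> carrier L" using X Z s z hA by simp_all
      have "?u \<oplus>\<^bsub>L\<^esub> ?v \<in> ?N"
        by (rule swap[OF Z X k I.I_l_closed[OF h s]])
      moreover have "?v \<in> ?N"
        using diag[OF X k I.I_l_closed[OF h z]] unfolding m_lcomm[OF s z hA] .
      ultimately have "(?v \<oplus>\<^bsub>L\<^esub> ?u) \<ominus>\<^bsub>L\<^esub> ?v \<in> ?N"
        unfolding L.M.a_comm[OF uv] by (rule N(5))
      then have "?u \<in> ?N" unfolding L.M.add_diff_cancel_left[OF uv(2,1)] .
      then show ?thesis unfolding m_assoc[OF s s hA] .
    qed
    then show "?s \<otimes>\<^bsub>A\<^esub> ?s \<in> J" using X k by (simp add: J_def)
  qed
  then show ?thesis using h Z I.Icarr[OF h] by (auto simp: J_def)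
qed

text \<open>
  The generators satisfy \<open>f [X, Y] = [f X, Y] + Y(f) X\<close>, and the last term lies in \<open>[L, K]\<close> because
  \<open>Y(f)\<close> is a multiplier.
\<close>

lemma modular_lie_br_span:
  assumes two: "\<one>\<^bsub>R\<^esub> \<oplus>\<^bsub>R\<^esub> \<one>\<^bsub>R\<^esub> \<in> Units R" and ns: "strongly_nonsingular R A L"
  shows "modular A L (lie_br_span R A L (carrier L) K)" (is "modular A L ?N")
proof -
  note N = restricted_submoduleD[OF submodule_lie_br_span]
  have core: "submodule (modular_core ?N) A L"
    by (rule submodule_modular_core[OF submodule_lie_br_span])
  have "lie_br L X Y \<in> modular_core ?N" if X: "X \<in> carrier L" and Y: "Y \<in> K" for X Y
  proof -
    note YL = lie_ideal_carrier[OF Y]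
    have "f \<odot>\<^bsub>L\<^esub> lie_br L X Y \<in> ?N" if f: "f \<in> carrier A" for f
    proof -
      have "lie_br L (f \<odot>\<^bsub>L\<^esub> X) Y \<oplus>\<^bsub>L\<^esub> anchor L Y f \<odot>\<^bsub>L\<^esub> X \<in> ?N"
        using X Y f anchor_mem_multiplier_ideal[OF two ns Y f]
        by (intro N(4) lie_br_mem_lie_br_span multiplier_ideal_smult_mem_lie_br_span[OF two ns]) auto
      then show ?thesis
        using X YL f by (simp add: lie_br_smult_left a_minus_def L.M.a_assoc L.M.l_neg)
    qed
    then show ?thesis using X YL by (simp add: modular_core_def)
  qed
  then have "?N \<subseteq> modular_core ?N"
    by (rule lie_br_span_least[OF restricted_submodule_if_modular[OF core]])
  then have "modular_core ?N = ?N" using modular_core_subset by blast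
  then show ?thesis using core by (simp add: modular_def)
qed

text \<open>
  For \<open>Y \<in> K\<close> the scalars \<open>a\<close> with \<open>a Y \<in> [L, K]\<close> form an ideal by modularity of \<open>[L, K]\<close>, and it contains
  \<open>X(k)\<close> because \<open>X(k) Y = [X, k Y] - k [X, Y]\<close>, where \<open>k Y \<in> K\<close> by modularity of \<open>K\<close>.
\<close>

lemma lie_br_span_eq_if_modular:
  assumes two: "\<one>\<^bsub>R\<^esub> \<oplus>\<^bsub>R\<^esub> \<one>\<^bsub>R\<^esub> \<in> Units R" and ns: "strongly_nonsingular R A L"
    and mod: "modular A L K"
  shows "lie_br_span R A L (carrier L) K = K" (is "?N = K")
proof
  show "?N \<subseteq> K" by (rule lie_br_span_subset)
  show "K \<subseteq> ?N"
  proof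
    fix Y assume Y: "Y \<in> K"
    note YL = lie_ideal_carrier[OF Y]
    have N: "submodule ?N A L" using modular_lie_br_span[OF two ns] by (simp add: modular_def)
    note NE = L.submoduleE[OF N] and N0 = restricted_submoduleD[OF submodule_lie_br_span]
    define T where "T = {a \<in> carrier A. a \<odot>\<^bsub>L\<^esub> Y \<in> ?N}"
    have "ideal T A"
      using YL N0(2,4) NE(4) by (intro idealI_commutative) (auto simp: T_def L.smult_l_distr L.smult_assoc1)
    then have "\<one>\<^bsub>A\<^esub> \<in> T"
    proof (rule one_mem_ideal_if_anchor_squares[OF ns])
      fix X k assume X: "X \<in> carrier L" and k: "k \<in> carrier A"
      have kY: "k \<odot>\<^bsub>L\<^esub> Y \<in> K" using L.submoduleE(4) mod k Y by (simp add: modular_def)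
      have "lie_br L X (k \<odot>\<^bsub>L\<^esub> Y) \<ominus>\<^bsub>L\<^esub> k \<odot>\<^bsub>L\<^esub> lie_br L X Y \<in> ?N"
        using X k Y kY by (intro N0(5) NE(4) lie_br_mem_lie_br_span) auto
      then have "anchor L X k \<odot>\<^bsub>L\<^esub> Y \<in> ?N"
        using X k YL by (simp add: lie_br_leibniz L.M.add_diff_cancel_left)
      then show "anchor L X k \<otimes>\<^bsub>A\<^esub> anchor L X k \<in> T"
        using X k YL NE(4) by (simp add: T_def L.smult_assoc1)
    qed
    then show "Y \<in> ?N" using YL by (simp add: T_def)
  qed
qed

lemma multiplier_ideal_sandwich:
  assumes two: "\<one>\<^bsub>R\<^esub> \<oplus>\<^bsub>R\<^esub> \<one>\<^bsub>R\<^esub> \<in> Units R" and ns: "strongly_nonsingular R A L"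
  shows "anchor_image_span R A L K \<subseteq> multiplier_ideal K"
    and "ideal_smult A L (multiplier_ideal K) \<subseteq> K"
    and "K \<subseteq> anchor_into A L (multiplier_ideal K)"
proof -
  interpret I: ideal "multiplier_ideal K" A by (rule ideal_multiplier_ideal[OF lie_ideal_submodule])
  show "anchor_image_span R A L K \<subseteq> multiplier_ideal K"
    unfolding anchor_image_span_def
    using anchor_mem_multiplier_ideal[OF two ns]
    by (intro module.module_span_least[OF algebra.module[OF algebra_axioms]] submodule_ideal I.ideal_axioms) auto
  show "K \<subseteq> anchor_into A L (multiplier_ideal K)"
    using anchor_mem_multiplier_ideal[OF two ns] lie_ideal_carrier by (auto simp: anchor_into_def)
  have "ideal_smult A L (multiplier_ideal K) \<subseteq> modular_core K"
    unfolding ideal_smult_def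
  proof (intro L.module_span_least submodule_modular_core lie_ideal_submodule subsetI)
    fix Z assume "Z \<in> {f \<odot>\<^bsub>L\<^esub> X |f X. f \<in> multiplier_ideal K \<and> X \<in> carrier L}"
    then obtain f X where Z: "Z = f \<odot>\<^bsub>L\<^esub> X" "f \<in> multiplier_ideal K" "X \<in> carrier L" by auto
    have "g \<odot>\<^bsub>L\<^esub> Z \<in> K" if g: "g \<in> carrier A" for g
    proof -
      have "(g \<otimes>\<^bsub>A\<^esub> f) \<odot>\<^bsub>L\<^esub> X \<in> K"
        using I.I_l_closed[OF Z(2) g] Z(3) unfolding multiplier_ideal_def by blast
      then show ?thesis unfolding Z(1) L.smult_assoc1[OF g I.Icarr[OF Z(2)] Z(3)] .
    qed
    moreover have "Z \<in> carrier L" using Z I.Icarr[OF Z(2)] by simp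
    ultimately show "Z \<in> modular_core K" unfolding modular_core_def by blast
  qed
  then show "ideal_smult A L (multiplier_ideal K) \<subseteq> K" using modular_core_subset by blast
qed

end

end

theorem theorem3:
  fixes R :: "('r, 'k) ring_scheme"
    and A :: "('r, 'a, 'n) module_scheme"
    and L :: "('a, 'l, 'p) lie_pseudoalgebra_scheme"
  assumes "lie_pseudoalgebra R A L"
    and "\<one>\<^bsub>R\<^esub> \<oplus>\<^bsub>R\<^esub> \<one>\<^bsub>R\<^esub> \<in> Units R"
    and "strongly_nonsingular R A L"
  shows "(\<forall>K. lie_ideal R A L K \<longrightarrow>
        (\<exists>I. ideal I A \<and> anchor_invariant L I \<and> anchor_image_span R A L K \<subseteq> I
           \<and> ideal_smult A L I \<subseteq> K \<and> K \<subseteq> anchor_into A L I))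
    \<and> (\<forall>K. lie_ideal R A L K \<longrightarrow>
        lie_ideal R A L (lie_br_span R A L (carrier L) K)
        \<and> modular A L (lie_br_span R A L (carrier L) K)
        \<and> (modular A L K \<longleftrightarrow> lie_br_span R A L (carrier L) K = K))"
proof -
  interpret lie_pseudoalgebra R A L by fact
  show ?thesis
  proof (intro conjI allI impI)
    fix K assume K: "lie_ideal R A L K"
    show "\<exists>I. ideal I A \<and> anchor_invariant L I \<and> anchor_image_span R A L K \<subseteq> I
        \<and> ideal_smult A L I \<subseteq> K \<and> K \<subseteq> anchor_into A L I"
      using ideal_multiplier_ideal[OF lie_ideal_submodule[OF K]] anchor_invariant_multiplier_ideal[OF K]
        multiplier_ideal_sandwich[OF K assms(2,3)] by blast
    show "lie_ideal R A L (lie_br_span R A L (carrier L) K)" by (rule lie_ideal_lie_br_span[OF K])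
    show N: "modular A L (lie_br_span R A L (carrier L) K)"
      by (rule modular_lie_br_span[OF K assms(2,3)])
    show "modular A L K \<longleftrightarrow> lie_br_span R A L (carrier L) K = K"
      using N lie_br_span_eq_if_modular[OF K assms(2,3)] by metis
  qed
qed

end
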